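(* Let $\rho,\sigma>0$ be given constants. Then for any $x\in X$ the function $\phi_{\rho,\sigma}$ is differentiable at $x$, and its gradient is given by $$\nabla\phi_{\rho,\sigma}(x)=\nabla_xF(x,y^*_{\rho,\sigma}(x))-\rho\,\nabla_xf(x,y^*_{\rho,\sigma}(x))+\rho\,\nabla_xf(x,z^*_{\rho,\sigma}(x)),$$ where $(y^*_{\rho,\sigma}(x),z^*_{\rho,\sigma}(x))$ is the unique saddle point of the minimax problem $\min_{z\in Y}\max_{y\in Y}\psi_{\rho,\sigma}(x,y,z)$ defining $\phi_{\rho,\sigma}(x)$.
   Context: Setting: $X\subseteq\mathbb{R}^n$ and $Y\subseteq\mathbb{R}^m$ are closed convex sets, $F,f:\mathbb{R}^n\times\mathbb{R}^m\to\mathbb{R}$, and $\mathcal{S}(x):=\arg\min_{y'\in Y}f(x,y')$. Standing assumptions: (1) $F$ is continuously differentiable, $\nabla F$ is Lipschitz continuous on $X\times Y$, and for some $\mu>0$, for every fixed $x\in X$, $F(x,\cdot)$ is $\mu$-strongly concave on $Y$. (2) $f$ is continuously differentiable, $\nabla f$ is Lipschitz continuous on $X\times Y$, and for every fixed $x\in X$, $f(x,\cdot)$ is convex on $Y$; $\mathcal{S}(x)\neq\varnothing$ for all $x\in X$; and for any bounded set $B\subseteq X$ there is a bounded set $D$ such that $\mathcal{S}(x)\cap D\ne\varnothing$ for every $x\in B$. For $\rho,\sigma>0$, $x\in X$ and $y,z\in Y$ define $$\psi_{\rho,\sigma}(x,y,z):=F(x,y)-\rho(f(x,y)-f(x,z))+\frac{\sigma}{2}\|z\|^2-\sigma\langle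 y,z\rangle,\qquad \phi_{\rho,\sigma}(x):=\min_{z\in Y}\max_{y\in Y}\psi_{\rho,\sigma}(x,y,z).$$ The function $\psi_{\rho,\sigma}(x,\cdot,\cdot)$ is strongly concave in $y$ and strongly convex in $z$; its unique saddle point $(y^*_{\rho,\sigma}(x),z^*_{\rho,\sigma}(x))\in Y\times Y$ is the point satisfying $\psi_{\rho,\sigma}(x,y,z^*_{\rho,\sigma}(x))\le\psi_{\rho,\sigma}(x,y^*_{\rho,\sigma}(x),z^*_{\rho,\sigma}(x))\le\psi_{\rho,\sigma}(x,y^*_{\rho,\sigma}(x),z)$ for all $y,z\in Y$. Since $\phi_{\rho,\sigma}$ is considered on $X$, differentiability at $x\in X$ with gradient $g$ means $\phi_{\rho,\sigma}(x')=\phi_{\rho,\sigma}(x)+\langle g,x'-x\rangle+o(\|x'-x\|)$ as $x'\to x$, $x'\in X$ (the usual notion at interior points of $X$). *)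

theory Defs
  imports "HOL-Analysis.Analysis"
begin

definition grad :: "('a::real_inner \<Rightarrow> real) \<Rightarrow> 'a \<Rightarrow> 'a" where
  "grad g x = (THE d. GDERIV g x :> d)"

definition continuously_differentiable :: "('a::real_inner \<Rightarrow> real) \<Rightarrow> bool" where
  "continuously_differentiable g \<longleftrightarrow>
     (\<forall>x. g differentiable (at x)) \<and> continuous_on UNIV (grad g)"

definition strongly_concave_on :: "'a::real_inner set \<Rightarrow> real \<Rightarrow> ('a \<Rightarrow> real) \<Rightarrow> bool" where
  "strongly_concave_on S \<mu> g \<longleftrightarrow> convex S \<and>
     (\<forall>x\<in>S. \<forall>y\<in>S. \<forall>u\<ge>0. \<forall>v\<ge>0. u + v = 1 \<longrightarrow>
        u * g x + v * g y + \<mu> / 2 * u * v * (norm (x - y))\<^sup>2 \<le> g (u *\<^sub>R x + v *\<^sub>R y))"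

text \<open>Attained extremal values: unlike \<open>INF\<close> and \<open>SUP\<close>, these are specified only
  if the minimum (maximum) exists.\<close>

definition min_on :: "'a set \<Rightarrow> ('a \<Rightarrow> real) \<Rightarrow> real" where
  "min_on A g = (LEAST v. v \<in> g ` A)"

definition max_on :: "'a set \<Rightarrow> ('a \<Rightarrow> real) \<Rightarrow> real" where
  "max_on A g = (GREATEST v. v \<in> g ` A)"

definition lower_sol :: "('a \<times> 'b \<Rightarrow> real) \<Rightarrow> 'b set \<Rightarrow> 'a \<Rightarrow> 'b set" where
  "lower_sol f Y x = {y. is_arg_min (\<lambda>y'. f (x, y')) (\<lambda>y'. y' \<in> Y) y}"

definition psi ::
  "('a \<times> 'b::real_inner \<Rightarrow> real) \<Rightarrow> ('a \<times> 'b \<Rightarrow> real) \<Rightarrow> real \<Rightarrow> real \<Rightarrow> 'a \<Rightarrow> 'b \<Rightarrow> 'b \<Rightarrow> real" where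
  "psi F f \<rho> \<sigma> x y z =
     F (x, y) - \<rho> * (f (x, y) - f (x, z)) + \<sigma> / 2 * (norm z)\<^sup>2 - \<sigma> * (y \<bullet> z)"

definition phi ::
  "('a \<times> 'b::real_inner \<Rightarrow> real) \<Rightarrow> ('a \<times> 'b \<Rightarrow> real) \<Rightarrow> 'b set \<Rightarrow> real \<Rightarrow> real \<Rightarrow> 'a \<Rightarrow> real" where
  "phi F f Y \<rho> \<sigma> x = min_on Y (\<lambda>z. max_on Y (\<lambda>y. psi F f \<rho> \<sigma> x y z))"

text \<open>\<open>G\<close> is maximised in its first argument and minimised in its second.\<close>

definition saddle_point :: "'b set \<Rightarrow> ('b \<Rightarrow> 'b \<Rightarrow> real) \<Rightarrow> 'b \<times> 'b \<Rightarrow> bool" where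
  "saddle_point Y G p \<longleftrightarrow> p \<in> Y \<times> Y \<and>
     (\<forall>y\<in>Y. \<forall>z\<in>Y. G y (snd p) \<le> G (fst p) (snd p) \<and> G (fst p) (snd p) \<le> G (fst p) z)"

definition saddle ::
  "('a \<times> 'b::real_inner \<Rightarrow> real) \<Rightarrow> ('a \<times> 'b \<Rightarrow> real) \<Rightarrow> 'b set \<Rightarrow> real \<Rightarrow> real \<Rightarrow> 'a \<Rightarrow> 'b \<times> 'b" where
  "saddle F f Y \<rho> \<sigma> x = (THE p. saddle_point Y (psi F f \<rho> \<sigma> x) p)"

definition ystar ::
  "('a \<times> 'b::real_inner \<Rightarrow> real) \<Rightarrow> ('a \<times> 'b \<Rightarrow> real) \<Rightarrow> 'b set \<Rightarrow> real \<Rightarrow> real \<Rightarrow> 'a \<Rightarrow> 'b" where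
  "ystar F f Y \<rho> \<sigma> x = fst (saddle F f Y \<rho> \<sigma> x)"

definition zstar ::
  "('a \<times> 'b::real_inner \<Rightarrow> real) \<Rightarrow> ('a \<times> 'b \<Rightarrow> real) \<Rightarrow> 'b set \<Rightarrow> real \<Rightarrow> real \<Rightarrow> 'a \<Rightarrow> 'b" where
  "zstar F f Y \<rho> \<sigma> x = snd (saddle F f Y \<rho> \<sigma> x)"

end

theory Submission
  imports Defs
begin

text \<open>
  Up to the coupling \<open>- \<sigma> * (y \<bullet> z)\<close>, which does not involve \<open>x\<close>, the function \<open>psi\<close> splits into a
  strongly concave function of \<open>y\<close> and a strongly convex function of \<open>z\<close>. A saddle point is therefore
  a point of quadratic growth in both variables. Adding the growth inequalities for the saddle points
  at \<open>x\<close> and \<open>x'\<close> leaves only mixed differences of \<open>F\<close> and \<open>f\<close>, which the Lipschitz gradients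
  bound by a multiple of \<open>norm (x' - x)\<close> times the distance of the saddle points; so the saddle point
  depends Lipschitz continuously on \<open>x\<close>. The saddle inequalities sandwich the increment of \<open>phi\<close>
  between two increments of \<open>psi\<close> in \<open>x\<close> alone, taken at \<open>(y x, z x')\<close> and at \<open>(y x', z x)\<close>, and both
  have the claimed first-order expansion.
\<close>

section \<open>Strong concavity: quadratic growth and existence of maximisers\<close>

lemma strongly_concave_onD:
  assumes "strongly_concave_on S \<mu> g" "x \<in> S" "y \<in> S" "0 \<le> u" "0 \<le> v" "u + v = 1"
  shows "u * g x + v * g y + \<mu> / 2 * u * v * (norm (x - y))\<^sup>2 \<le> g (u *\<^sub>R x + v *\<^sub>R y)"
  using assms unfolding strongly_concave_on_def by blast

lemma strongly_concave_on_add_concave: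
  assumes g: "strongly_concave_on S \<mu> g" and h: "concave_on S h"
  shows "strongly_concave_on S \<mu> (\<lambda>y. g y + h y)"
  unfolding strongly_concave_on_def
proof (intro conjI ballI allI impI)
  show "convex S" using g by (simp add: strongly_concave_on_def)
  fix x y u v assume *: "x \<in> S" "y \<in> S" "0 \<le> u" "0 \<le> v" "u + v = (1::real)"
  have "u * h x + v * h y \<le> h (u *\<^sub>R x + v *\<^sub>R y)"
    using h * unfolding concave_on_iff by blast
  with strongly_concave_onD[OF g *]
  show "u * (g x + h x) + v * (g y + h y) + \<mu> / 2 * u * v * (norm (x - y))\<^sup>2
      \<le> g (u *\<^sub>R x + v *\<^sub>R y) + h (u *\<^sub>R x + v *\<^sub>R y)"
    by (simp add: algebra_simps)
qed

lemma concave_on_inner_add_const: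
  assumes "convex S"
  shows "concave_on S (\<lambda>y. c * (y \<bullet> z) + d)"
  unfolding concave_on_iff
proof (intro conjI ballI allI impI)
  fix x y u v assume "u + v = (1::real)"
  then have v: "v = 1 - u" by simp
  show "u * (c * (x \<bullet> z) + d) + v * (c * (y \<bullet> z) + d) \<le> c * ((u *\<^sub>R x + v *\<^sub>R y) \<bullet> z) + d"
    unfolding v by (simp add: inner_add_left algebra_simps)
qed (fact assms)

text \<open>Expanding the inner products shows that the defining inequality holds here with
  equality, for either sign of \<open>\<sigma>\<close>.\<close>

lemma strongly_concave_on_minus_norm_sq:
  fixes S :: "'a::real_inner set"
  assumes "convex S"
  shows "strongly_concave_on S \<sigma> (\<lambda>y. - (\<sigma> / 2 * (norm y)\<^sup>2))"
  unfolding strongly_concave_on_def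
proof (intro conjI ballI allI impI)
  fix x y :: 'a and u v assume "u + v = (1::real)"
  then have v: "v = 1 - u" by simp
  have "u * (norm x)\<^sup>2 + v * (norm y)\<^sup>2 - u * v * (norm (x - y))\<^sup>2
      = (norm (u *\<^sub>R x + v *\<^sub>R y))\<^sup>2"
    unfolding v power2_norm_eq_inner
    by (simp add: inner_add inner_diff inner_commute[of y x] algebra_simps power2_eq_square)
  then have "- (\<sigma> / 2) * (u * (norm x)\<^sup>2 + v * (norm y)\<^sup>2 - u * v * (norm (x - y))\<^sup>2)
      = - (\<sigma> / 2) * (norm (u *\<^sub>R x + v *\<^sub>R y))\<^sup>2"
    by simp
  then show "u * - (\<sigma> / 2 * (norm x)\<^sup>2) + v * - (\<sigma> / 2 * (norm y)\<^sup>2)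
      + \<sigma> / 2 * u * v * (norm (x - y))\<^sup>2 \<le> - (\<sigma> / 2 * (norm (u *\<^sub>R x + v *\<^sub>R y))\<^sup>2)"
    by (simp add: algebra_simps)
qed (fact assms)

text \<open>The maximiser \<open>m\<close> is compared with points of the segment from
  \<open>m\<close> to \<open>y\<close>. The linear gain along the segment is at most 0, and dividing
  by the step length leaves the quadratic term.\<close>

lemma strongly_concave_on_growth:
  assumes g: "strongly_concave_on S \<mu> g" and m: "m \<in> S" "\<And>y. y \<in> S \<Longrightarrow> g y \<le> g m" and y: "y \<in> S"
  shows "g y + \<mu> / 2 * (norm (y - m))\<^sup>2 \<le> g m"
proof -
  \<comment> \<open>Instead of a limit of the segment point towards \<open>m\<close>, it suffices to
    prove the bound with an extra factor \<open>u\<close> on the left for every \<open>u\<close>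
    strictly between 0 and 1.\<close>
  have "\<mu> / 2 * (norm (y - m))\<^sup>2 \<le> g m - g y"
  proof (rule field_le_mult_one_interval)
    fix u :: real assume u: "0 < u" "u < 1"
    define v where "v = 1 - u"
    have v: "v > 0" "u = 1 - v" using u by (auto simp: v_def)
    have S: "u *\<^sub>R m + v *\<^sub>R y \<in> S"
      using g m y u v by (auto simp: strongly_concave_on_def intro: convexD)
    have "u * g m + v * g y + \<mu> / 2 * u * v * (norm (m - y))\<^sup>2 \<le> g (u *\<^sub>R m + v *\<^sub>R y)"
      using strongly_concave_onD[OF g m(1) y, of u v] u v by simp
    also have "\<dots> \<le> g m" using m S by blast
    finally have "u * g m + v * g y + \<mu> / 2 * u * v * (norm (m - y))\<^sup>2 \<le> g m" .
    moreover have "u * g m = g m - v * g m" by (simp add: v_def algebra_simps)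
    ultimately have "v * (u * (\<mu> / 2 * (norm (y - m))\<^sup>2)) \<le> v * (g m - g y)"
      by (simp add: norm_minus_commute algebra_simps)
    then show "u * (\<mu> / 2 * (norm (y - m))\<^sup>2) \<le> g m - g y"
      using v(1) by (simp only: mult_le_cancel_left_pos)
  qed
  then show ?thesis by simp
qed

text \<open>\<open>S\<close> may be unbounded, so compactness has to come from coercivity. A bound
  for \<open>g\<close> on the unit ball around a point \<open>p\<close> of \<open>S\<close>, carried
  outwards by strong concavity, forces \<open>g y < g p\<close> far from \<open>p\<close>. A maximum
  over a large ball is then global.\<close>

lemma strongly_concave_on_attains_max:
  fixes S :: "'a::euclidean_space set"
  assumes g: "strongly_concave_on S \<mu> g" and \<mu>: "\<mu> > 0" and S: "closed S" "S \<noteq> {}"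
    and cont: "continuous_on S g"
  obtains m where "m \<in> S" "\<And>y. y \<in> S \<Longrightarrow> g y \<le> g m"
proof -
  obtain p where p: "p \<in> S" using S by blast
  have "compact (S \<inter> cball p 1)" using S by (simp add: closed_Int_compact)
  moreover have "S \<inter> cball p 1 \<noteq> {}" using p by auto
  ultimately obtain k where k: "\<And>y. y \<in> S \<inter> cball p 1 \<Longrightarrow> g y \<le> g k"
    using continuous_attains_sup[of "S \<inter> cball p 1" g] continuous_on_subset[OF cont] by blast
  \<comment> \<open>\<open>R\<close> is the largest \<open>r\<close> compatible with
    \<open>g p + \<mu> / 2 * (r - 1) \<le> g k\<close>, the inequality derived below for a point
    \<open>y\<close> at distance \<open>r\<close> with \<open>g p \<le> g y\<close>.\<close>
  define R where "R = 1 + 2 * (g k - g p) / \<mu>"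
  have gk: "g p \<le> g k" using k[of p] p by simp
  then have R: "R \<ge> 1" using \<mu> by (simp add: R_def)
  have far: "g y < g p" if y: "y \<in> S" "dist p y > R" for y
  proof (rule ccontr)
    assume "\<not> g y < g p"
    then have yp: "g p \<le> g y" by simp
    define r where "r = norm (p - y)"
    have r: "r > R" "r > 1" using y R by (auto simp: r_def dist_norm)
    \<comment> \<open>With this weight, \<open>w\<close> is the point of the segment from
      \<open>p\<close> to \<open>y\<close> at distance exactly 1 from \<open>p\<close>, where
      \<open>g\<close> is bounded by \<open>g k\<close>.\<close>
    define v where "v = 1 / r"
    have v: "0 < v" "v < 1" "v * r = 1" using r by (auto simp: v_def)
    define w where "w = (1 - v) *\<^sub>R p + v *\<^sub>R y"
    have w: "w \<in> S"
      unfolding w_def using g p y v by (auto simp: strongly_concave_on_def intro: convexD)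
    have "dist p w = norm (v *\<^sub>R (p - y))"
      by (simp add: w_def dist_norm algebra_simps)
    also have "\<dots> = 1" using v by (simp add: r_def[symmetric])
    finally have "g w \<le> g k" using k w by simp
    moreover have "(1 - v) * g p + v * g y + \<mu> / 2 * (1 - v) * v * r\<^sup>2 \<le> g w"
      using strongly_concave_onD[OF g p y(1), of "1 - v" v] v by (simp add: r_def w_def)
    moreover have "\<mu> / 2 * (1 - v) * v * r\<^sup>2 = \<mu> / 2 * (r - v * r) * (v * r)"
      by (simp add: power2_eq_square algebra_simps)
    then have "\<mu> / 2 * (1 - v) * v * r\<^sup>2 = \<mu> / 2 * (r - 1)" unfolding v(3) by simp
    moreover have "(1 - v) * g p = g p - v * g p" by (simp add: algebra_simps)
    moreover have "v * g p \<le> v * g y" using yp v by simp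
    ultimately have "g p + \<mu> / 2 * (r - 1) \<le> g k" by linarith
    then have "r \<le> R" using \<mu> by (simp add: R_def field_simps)
    with r show False by simp
  qed
  have "compact (S \<inter> cball p R)" using S by (simp add: closed_Int_compact)
  moreover have pR: "p \<in> S \<inter> cball p R" using p R by auto
  ultimately obtain m where m: "m \<in> S \<inter> cball p R" "\<And>y. y \<in> S \<inter> cball p R \<Longrightarrow> g y \<le> g m"
    using continuous_attains_sup[of "S \<inter> cball p R" g] continuous_on_subset[OF cont] by blast
  show ?thesis
  proof
    show "m \<in> S" using m by simp
    show "g y \<le> g m" if "y \<in> S" for y
      using m(2)[of y] m(2)[OF pR] far[of y] that by (cases "dist p y \<le> R") auto
  qed
qed

section \<open>Saddle points of a separable function with bilinear coupling\<close>

lemma strongly_concave_on_bilinear: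
  assumes "strongly_concave_on S \<mu> a"
  shows "strongly_concave_on S \<mu> (\<lambda>y. a y + d - c * (y \<bullet> z))"
  using strongly_concave_on_add_concave[OF assms concave_on_inner_add_const[of S "- c" z d]] assms
  by (simp add: strongly_concave_on_def algebra_simps)

text \<open>With one variable frozen at its saddle value, the other optimises a strongly concave or
  convex function, because the coupling is then linear. Quadratic growth applies to each variable
  separately.\<close>

lemma saddle_point_growth:
  assumes a: "strongly_concave_on S \<mu> a" and b: "strongly_concave_on S \<nu> (\<lambda>z. - b z)"
    and p: "saddle_point S (\<lambda>y z. a y + b z - c * (y \<bullet> z)) (y, z)"
    and S: "y' \<in> S" "z' \<in> S"
  shows "a y' - c * (y' \<bullet> z) + \<mu> / 2 * (norm (y' - y))\<^sup>2 \<le> a y - c * (y \<bullet> z)" (is ?A)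
    and "b z - c * (y \<bullet> z) + \<nu> / 2 * (norm (z' - z))\<^sup>2 \<le> b z' - c * (y \<bullet> z')" (is ?B)
proof -
  have yz: "y \<in> S" "z \<in> S" using p by (auto simp: saddle_point_def)
  show ?A
    using strongly_concave_on_growth[OF strongly_concave_on_bilinear[OF a, of 0 c z] yz(1) _ S(1)] p yz
    by (fastforce simp: saddle_point_def)
  \<comment> \<open>Minimising in \<open>z\<close> means maximising the negated function, so the
    coupling enters with coefficient \<open>- c\<close>.\<close>
  show ?B
    using strongly_concave_on_growth[OF strongly_concave_on_bilinear[OF b, of 0 "- c" y] yz(2) _ S(2)] p yz
    by (fastforce simp: saddle_point_def inner_commute)
qed

text \<open>Each saddle point is tested at the other one. In the sum of the four growth inequalities
  every coupling term occurs once on each side and cancels.\<close>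

lemma saddle_point_perturbation:
  assumes a: "strongly_concave_on S \<mu> a" and b: "strongly_concave_on S \<nu> (\<lambda>z. - b z)"
    and a': "strongly_concave_on S \<mu> a'" and b': "strongly_concave_on S \<nu> (\<lambda>z. - b' z)"
    and p: "saddle_point S (\<lambda>y z. a y + b z - c * (y \<bullet> z)) (y, z)"
    and p': "saddle_point S (\<lambda>y z. a' y + b' z - c * (y \<bullet> z)) (y', z')"
  shows "\<mu> * (norm (y' - y))\<^sup>2 + \<nu> * (norm (z' - z))\<^sup>2
    \<le> ((a' y' - a y') - (a' y - a y)) - ((b' z' - b z') - (b' z - b z))"
proof -
  have S: "y \<in> S" "z \<in> S" "y' \<in> S" "z' \<in> S" using p p' by (auto simp: saddle_point_def)
  show ?thesis
    using saddle_point_growth[OF a b p S(3,4)] saddle_point_growth[OF a' b' p' S(1,2)]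
    by (simp add: norm_minus_commute)
qed

text \<open>Two saddle points of the same function make the right side of the perturbation estimate
  vanish.\<close>

lemma saddle_point_unique:
  assumes "strongly_concave_on S \<mu> a" "strongly_concave_on S \<nu> (\<lambda>z. - b z)" "\<mu> > 0" "\<nu> > 0"
    and "saddle_point S (\<lambda>y z. a y + b z - c * (y \<bullet> z)) p"
    and "saddle_point S (\<lambda>y z. a y + b z - c * (y \<bullet> z)) q"
  shows "p = q"
proof -
  have "\<mu> * (norm (fst q - fst p))\<^sup>2 + \<nu> * (norm (snd q - snd p))\<^sup>2 \<le> 0"
    using saddle_point_perturbation[OF assms(1,2,1,2), of c "fst p" "snd p" "fst q" "snd q"] assms(5,6)
    by simp
  moreover have "\<mu> * (norm (fst q - fst p))\<^sup>2 \<ge> 0" "\<nu> * (norm (snd q - snd p))\<^sup>2 \<ge> 0"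
    using assms(3,4) by auto
  ultimately have "\<mu> * (norm (fst q - fst p))\<^sup>2 = 0" "\<nu> * (norm (snd q - snd p))\<^sup>2 = 0"
    by linarith+
  then show ?thesis using assms(3,4) by (simp add: prod_eq_iff)
qed

text \<open>The inner maximiser \<open>m z\<close> is unique and continuous in \<open>z\<close>, and
  the optimal value \<open>A\<close> is convex. Hence \<open>b + A\<close> is strongly convex and
  has a minimiser \<open>z0\<close>; the pair \<open>(m z0, z0)\<close> is a saddle point.\<close>

lemma saddle_point_exists:
  fixes S :: "'a::euclidean_space set"
  assumes a: "strongly_concave_on S \<mu> a" and b: "strongly_concave_on S \<nu> (\<lambda>z. - b z)"
    and pos: "\<mu> > 0" "\<nu> > 0"
    and S: "closed S" "S \<noteq> {}" and cont: "continuous_on S a" "continuous_on S b"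
  shows "\<exists>p. saddle_point S (\<lambda>y z. a y + b z - c * (y \<bullet> z)) p"
proof -
  have conv: "convex S" using a by (simp add: strongly_concave_on_def)
  have "\<exists>m. m \<in> S \<and> (\<forall>y\<in>S. a y - c * (y \<bullet> z) \<le> a m - c * (m \<bullet> z))" for z
  proof -
    have "continuous_on S (\<lambda>y. a y + 0 - c * (y \<bullet> z))"
      by (intro continuous_intros cont)
    then obtain m where "m \<in> S" "\<And>y. y \<in> S \<Longrightarrow> a y + 0 - c * (y \<bullet> z) \<le> a m + 0 - c * (m \<bullet> z)"
      using strongly_concave_on_attains_max[OF strongly_concave_on_bilinear[OF a, of 0 c z] pos(1) S]
      by metis
    then show ?thesis by auto
  qed
  then obtain m where m: "\<And>z. m z \<in> S"
    and m_max: "\<And>z y. y \<in> S \<Longrightarrow> a y - c * (y \<bullet> z) \<le> a (m z) - c * (m z \<bullet> z)"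
    by metis
  have growth: "a y - c * (y \<bullet> z) + \<mu> / 2 * (norm (y - m z))\<^sup>2 \<le> a (m z) - c * (m z \<bullet> z)"
    if "y \<in> S" for y z
    using strongly_concave_on_growth[OF strongly_concave_on_bilinear[OF a, of 0 c z] m _ that] m_max
    by simp
  \<comment> \<open>The growth inequalities at \<open>z\<close> and \<open>w\<close>, each tested at
    the other maximiser, are added: the values of \<open>a\<close> cancel. Continuity of
    \<open>m\<close> serves both for continuity of \<open>A\<close> and for the limit at the
    end.\<close>
  have "(\<bar>c\<bar> / \<mu>)-lipschitz_on UNIV m"
  proof (rule lipschitz_onI)
    fix z w
    let ?d = "norm (m z - m w)"
    have "\<mu> * ?d\<^sup>2 \<le> c * ((m w - m z) \<bullet> (z - w))"
      using growth[OF m, of z w] growth[OF m, of w z]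
      by (simp add: norm_minus_commute inner_diff algebra_simps)
    also have "\<dots> \<le> \<bar>c\<bar> * \<bar>(m w - m z) \<bullet> (z - w)\<bar>"
      by (metis abs_ge_self abs_mult)
    also have "\<dots> \<le> \<bar>c\<bar> * (?d * norm (z - w))"
      by (intro mult_left_mono) (auto simp: norm_minus_commute intro: order.trans[OF Cauchy_Schwarz_ineq2])
    finally have "?d * (\<mu> * ?d) \<le> ?d * (\<bar>c\<bar> * norm (z - w))"
      by (simp add: power2_eq_square algebra_simps)
    then have "\<mu> * ?d \<le> \<bar>c\<bar> * norm (z - w)"
      by (cases "?d = 0") auto
    then show "dist (m z) (m w) \<le> \<bar>c\<bar> / \<mu> * dist z w"
      using pos by (simp add: dist_norm field_simps)
  qed (use pos in simp)
  then have cont_m: "continuous_on T m" for T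
    using lipschitz_on_continuous_on continuous_on_subset by blast
  define A where "A z = a (m z) - c * (m z \<bullet> z)" for z
  have cont_am: "continuous_on T (\<lambda>z. a (m z))" for T
    by (rule continuous_on_compose2[OF cont(1) cont_m]) (use m in auto)
  \<comment> \<open>\<open>A\<close> is a maximum of functions affine in \<open>z\<close>. The
    maximiser \<open>?w\<close> at the convex combination is a competitor at both \<open>x\<close>
    and \<open>y\<close>.\<close>
  have "concave_on S (\<lambda>z. - A z)"
    unfolding concave_on_iff
  proof (intro conjI ballI allI impI)
    fix x y u v assume *: "x \<in> S" "y \<in> S" "0 \<le> u" "0 \<le> v" "u + v = (1::real)"
    let ?w = "m (u *\<^sub>R x + v *\<^sub>R y)"
    have "A (u *\<^sub>R x + v *\<^sub>R y) = (u + v) * a ?w - c * (?w \<bullet> (u *\<^sub>R x + v *\<^sub>R y))"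
      using * by (simp add: A_def)
    also have "\<dots> = u * (a ?w - c * (?w \<bullet> x)) + v * (a ?w - c * (?w \<bullet> y))"
      by (simp add: inner_add algebra_simps)
    also have "\<dots> \<le> u * A x + v * A y"
      unfolding A_def by (intro add_mono mult_left_mono m_max m *)
    finally show "u * - A x + v * - A y \<le> - A (u *\<^sub>R x + v *\<^sub>R y)" by simp
  qed (fact conv)
  then have sc: "strongly_concave_on S \<nu> (\<lambda>z. - b z + - A z)"
    by (rule strongly_concave_on_add_concave[OF b])
  have "continuous_on S (\<lambda>z. - b z + - A z)"
    unfolding A_def by (intro continuous_intros cont cont_am cont_m)
  then obtain z0 where z0: "z0 \<in> S" "\<And>z. z \<in> S \<Longrightarrow> - b z + - A z \<le> - b z0 + - A z0"
    using strongly_concave_on_attains_max[OF sc pos(2) S] by blast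
  txt \<open>Minimality of \<open>z0\<close> only controls \<open>b + A\<close>; comparing along the segment from \<open>z0\<close> to \<open>z\<close>, where
    the maximiser is \<open>m (w t)\<close>, and letting \<open>t\<close> tend to 0 freezes the maximiser at \<open>m z0\<close>.\<close>
  have right: "b z0 - c * (m z0 \<bullet> z0) \<le> b z - c * (m z0 \<bullet> z)" if z: "z \<in> S" for z
  proof -
    define w where "w t = z0 + t *\<^sub>R (z - z0)" for t
    have "b z0 - c * (m (w t) \<bullet> z0) \<le> b z - c * (m (w t) \<bullet> z)" if t: "0 < t" "t < 1" for t
    proof -
      have wt: "w t = (1 - t) *\<^sub>R z0 + t *\<^sub>R z" by (simp add: w_def algebra_simps)
      then have wS: "w t \<in> S" using conv z z0 t by (auto intro: convexD)
      have "b z0 + (a (m (w t)) - c * (m (w t) \<bullet> z0)) \<le> b z0 + A z0"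
        unfolding A_def using m_max[OF m] by simp
      also have "\<dots> \<le> b (w t) + A (w t)" using z0(2)[OF wS] by simp
      finally have 1: "b z0 - c * (m (w t) \<bullet> z0) \<le> b (w t) - c * (m (w t) \<bullet> w t)"
        by (simp add: A_def)
      have "0 \<le> \<nu> / 2 * (1 - t) * t * (norm (z0 - z))\<^sup>2"
        using pos t by simp
      then have "b (w t) \<le> (1 - t) * b z0 + t * b z"
        using strongly_concave_onD[OF b z0(1) z, of "1 - t" t] t by (simp add: wt)
      with 1 have "t * (b z0 - c * (m (w t) \<bullet> z0)) \<le> t * (b z - c * (m (w t) \<bullet> z))"
        by (simp add: wt inner_add algebra_simps)
      then show ?thesis using t by (simp only: mult_le_cancel_left_pos)
    qed
    then have ev: "\<forall>\<^sub>F t in at_right 0. b z0 - c * (m (w t) \<bullet> z0) \<le> b z - c * (m (w t) \<bullet> z)"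
      unfolding eventually_at_right_field by (intro exI[of _ 1]) auto
    have "continuous_on UNIV (\<lambda>t. m (w t))"
      by (rule continuous_on_compose2[OF cont_m[of UNIV]]) (auto simp: w_def intro!: continuous_intros)
    then have "((\<lambda>t. m (w t)) \<longlongrightarrow> m (w 0)) (at 0)"
      by (simp add: continuous_on_def)
    then have lim: "((\<lambda>t. m (w t)) \<longlongrightarrow> m z0) (at_right 0)"
      by (auto simp: w_def intro: tendsto_within_subset)
    show ?thesis
      by (rule tendsto_le[OF _ _ _ ev]) (auto intro!: tendsto_intros lim)
  qed
  have "saddle_point S (\<lambda>y z. a y + b z - c * (y \<bullet> z)) (m z0, z0)"
    using m z0(1) m_max[of _ z0] right unfolding saddle_point_def by fastforce
  then show ?thesis ..
qed

section \<open>Attained extremal values and the minimax value\<close>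

lemma max_on_eqI:
  assumes "m \<in> S" "\<And>y. y \<in> S \<Longrightarrow> g y \<le> g m"
  shows "max_on S g = g m"
  unfolding max_on_def by (rule Greatest_equality) (use assms in auto)

lemma min_on_eqI:
  assumes "m \<in> S" "\<And>y. y \<in> S \<Longrightarrow> g m \<le> g y"
  shows "min_on S g = g m"
  unfolding min_on_def by (rule Least_equality) (use assms in auto)

text \<open>For every \<open>w\<close>, the maximum over the first argument is at least
  \<open>G y w\<close>, hence at least the saddle value, with equality at \<open>z\<close>.
  Attainment for every \<open>w\<close> is assumed because \<open>max_on\<close> has the intended
  value only where a maximum exists.\<close>

lemma min_max_eq_saddle_value:
  assumes p: "saddle_point S G (y, z)"
    and max: "\<And>w. w \<in> S \<Longrightarrow> \<exists>m\<in>S. \<forall>v\<in>S. G v w \<le> G m w"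
  shows "min_on S (\<lambda>z. max_on S (\<lambda>y. G y z)) = G y z"
proof -
  have S: "y \<in> S" "z \<in> S" and yz: "\<And>v. v \<in> S \<Longrightarrow> G v z \<le> G y z" "\<And>w. w \<in> S \<Longrightarrow> G y z \<le> G y w"
    using p by (auto simp: saddle_point_def)
  have val: "max_on S (\<lambda>y. G y z) = G y z"
    using max_on_eqI[OF S(1), of "\<lambda>y. G y z"] yz by blast
  have "max_on S (\<lambda>y. G y z) \<le> max_on S (\<lambda>y. G y w)" if w: "w \<in> S" for w
  proof -
    obtain m where m: "m \<in> S" "\<And>v. v \<in> S \<Longrightarrow> G v w \<le> G m w" using max w by blast
    then have "max_on S (\<lambda>y. G y w) = G m w" by (rule max_on_eqI)
    then show ?thesis using val yz(2)[OF w] m(2)[OF S(1)] by simp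
  qed
  then show ?thesis using min_on_eqI[OF S(2), of "\<lambda>z. max_on S (\<lambda>y. G y z)"] val by simp
qed

section \<open>Gradients, partial derivatives and continuity of sections\<close>

lemma grad_eqI:
  assumes "GDERIV g x :> d"
  shows "grad g x = d"
  unfolding grad_def
proof (rule the_equality)
  show "GDERIV g x :> d" by (fact assms)
  fix e assume "GDERIV g x :> e"
  then have "(\<lambda>h. h \<bullet> e) = (\<lambda>h. h \<bullet> d)"
    using assms has_derivative_unique unfolding gderiv_def by blast
  then show "e = d" by (metis vector_eq_ldot)
qed

text \<open>\<open>grad\<close> is a definite description, so a representing vector must be
  exhibited: its coordinates are the values of the derivative on the basis.\<close>

lemma has_derivative_grad:
  fixes g :: "'a::euclidean_space \<Rightarrow> real"
  assumes "g differentiable (at x)"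
  shows "(g has_derivative (\<lambda>h. h \<bullet> grad g x)) (at x)"
proof -
  obtain D where D: "(g has_derivative D) (at x)"
    using assms by (auto simp: differentiable_def)
  interpret D: bounded_linear D using D by (rule has_derivative_bounded_linear)
  define d where "d = (\<Sum>b\<in>Basis. D b *\<^sub>R b)"
  have "D h = h \<bullet> d" for h
  proof -
    have "D h = D (\<Sum>b\<in>Basis. (h \<bullet> b) *\<^sub>R b)" by (simp add: euclidean_representation)
    also have "\<dots> = h \<bullet> d" by (simp add: D.sum D.scaleR d_def inner_sum_right mult.commute)
    finally show ?thesis .
  qed
  then have "D = (\<lambda>h. h \<bullet> d)" by blast
  then have "GDERIV g x :> d" using D by (simp add: gderiv_def)
  then show ?thesis using grad_eqI[of g x d] by (simp add: gderiv_def)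
qed

lemma has_derivative_Pair_left:
  fixes h :: "'a::euclidean_space \<times> 'b::euclidean_space \<Rightarrow> real"
  assumes "h differentiable (at (x, y))"
  shows "((\<lambda>x. h (x, y)) has_derivative (\<lambda>v. v \<bullet> fst (grad h (x, y)))) (at x within T)"
proof -
  have "((\<lambda>x. (x, y)) has_derivative (\<lambda>v. (v, 0))) (at x within T)"
    by (auto intro!: derivative_eq_intros)
  from has_derivative_compose[OF this has_derivative_grad[OF assms]]
  show ?thesis by (simp add: inner_prod_def)
qed

lemma has_derivative_Pair_right:
  fixes h :: "'a::euclidean_space \<times> 'b::euclidean_space \<Rightarrow> real"
  assumes "h differentiable (at (x, y))"
  shows "((\<lambda>y. h (x, y)) has_derivative (\<lambda>v. v \<bullet> snd (grad h (x, y)))) (at y within T)"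
proof -
  have "((\<lambda>y. (x, y)) has_derivative (\<lambda>v. (0, v))) (at y within T)"
    by (auto intro!: derivative_eq_intros)
  from has_derivative_compose[OF this has_derivative_grad[OF assms]]
  show ?thesis by (simp add: inner_prod_def)
qed

lemma grad_Pair_left:
  fixes h :: "'a::euclidean_space \<times> 'b::euclidean_space \<Rightarrow> real"
  assumes "h differentiable (at (x, y))"
  shows "grad (\<lambda>x. h (x, y)) x = fst (grad h (x, y))"
  by (rule grad_eqI) (simp add: gderiv_def has_derivative_Pair_left[OF assms])

lemma continuous_on_Pair_right:
  assumes "continuously_differentiable h"
  shows "continuous_on T (\<lambda>y. h (x, y))"
proof (rule continuous_on_compose2[of UNIV h])
  show "continuous_on UNIV h"
    using assms unfolding continuously_differentiable_def
    by (meson differentiable_imp_continuous_within continuous_at_imp_continuous_on)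
qed (auto intro: continuous_on_Pair continuous_on_const continuous_on_id)

section \<open>Mixed differences and partial increments\<close>

lemma onorm_inner_diff_le:
  "onorm (\<lambda>v. v \<bullet> d - v \<bullet> e) \<le> norm (d - e)"
proof (rule onorm_bound)
  show "norm (v \<bullet> d - v \<bullet> e) \<le> norm (d - e) * norm v" for v
    using Cauchy_Schwarz_ineq2[of v "d - e"] by (simp add: inner_diff_right mult.commute)
qed simp

text \<open>The mean value inequality is applied in the second variable to
  \<open>h (x', y) - h (x, y)\<close>. Its derivative is a difference of gradient components at two
  points that differ only by \<open>x' - x\<close>, which the Lipschitz constant controls.\<close>

lemma mixed_difference_le:
  fixes h :: "'a::euclidean_space \<times> 'b::euclidean_space \<Rightarrow> real"
  assumes diff: "\<And>p. h differentiable (at p)" and L: "L-lipschitz_on (X \<times> Y) (grad h)"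
    and Y: "convex Y" and X: "x \<in> X" "x' \<in> X" and y: "y \<in> Y" "y' \<in> Y"
  shows "\<bar>(h (x', y') - h (x, y')) - (h (x', y) - h (x, y))\<bar> \<le> L * norm (x' - x) * norm (y' - y)"
proof -
  have "norm ((h (x', y') - h (x, y')) - (h (x', y) - h (x, y))) \<le> L * norm (x' - x) * norm (y' - y)"
  proof (rule differentiable_bound[OF Y _ _ y(2,1)])
    fix w assume w: "w \<in> Y"
    show "((\<lambda>y. h (x', y) - h (x, y)) has_derivative
        (\<lambda>v. v \<bullet> snd (grad h (x', w)) - v \<bullet> snd (grad h (x, w)))) (at w within Y)"
      by (intro has_derivative_diff has_derivative_Pair_right diff)
    have "norm (snd (grad h (x', w)) - snd (grad h (x, w))) \<le> norm (grad h (x', w) - grad h (x, w))"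
      by (metis norm_snd_le prod.collapse snd_diff)
    also have "\<dots> \<le> L * norm ((x', w) - (x, w))"
      using lipschitz_onD[OF L, of "(x', w)" "(x, w)"] X w by (simp add: dist_norm)
    finally show "onorm (\<lambda>v. v \<bullet> snd (grad h (x', w)) - v \<bullet> snd (grad h (x, w))) \<le> L * norm (x' - x)"
      using order_trans[OF onorm_inner_diff_le] by (simp add: norm_Pair)
  qed
  then show ?thesis by simp
qed

text \<open>The second argument moves with \<open>x'\<close>, so differentiability at a single point
  does not suffice; continuity of the gradient at \<open>(x, y)\<close> makes the linear
  approximation uniform over second arguments near \<open>y\<close>.\<close>

lemma partial_increment_tendsto:
  fixes h :: "'a::euclidean_space \<times> 'b::euclidean_space \<Rightarrow> real"
  assumes C1: "continuously_differentiable h" and w: "(w \<longlongrightarrow> y) (at x within X)"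
  shows "((\<lambda>x'. (h (x', w x') - h (x, w x') - fst (grad h (x, y)) \<bullet> (x' - x)) / norm (x' - x))
    \<longlongrightarrow> 0) (at x within X)"
proof (rule tendstoI)
  fix e :: real assume e: "e > 0"
  have diff: "\<And>p. h differentiable (at p)" and "continuous_on UNIV (grad h)"
    using C1 by (auto simp: continuously_differentiable_def)
  then have "isCont (grad h) (x, y)" by (simp add: continuous_on_eq_continuous_at)
  then obtain d where d: "d > 0"
    and dd: "\<And>p. dist p (x, y) < d \<Longrightarrow> dist (grad h p) (grad h (x, y)) < e / 2"
    using e unfolding continuous_at_eps_delta by (metis half_gt_zero)
  have "\<forall>\<^sub>F x' in at x within X. dist (w x') y < d / 2"
    using w d by (intro tendstoD) auto
  moreover have "\<forall>\<^sub>F x' in at x within X. x' \<in> ball x (d / 2) - {x}"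
    using eventually_at_ball'[of "d / 2" x X] d by (auto elim: eventually_mono)
  ultimately show "\<forall>\<^sub>F x' in at x within X.
    dist ((h (x', w x') - h (x, w x') - fst (grad h (x, y)) \<bullet> (x' - x)) / norm (x' - x)) 0 < e"
  proof eventually_elim
    case (elim x')
    let ?g = "fst (grad h (x, y))"
    \<comment> \<open>After subtracting the linear part, the derivative is small on a whole ball
      around \<open>x\<close>. The two radii \<open>d / 2\<close> add up to \<open>d\<close>, and
      the bound \<open>e / 2\<close> keeps the final inequality strict.\<close>
    have "norm ((h (x', w x') - x' \<bullet> ?g) - (h (x, w x') - x \<bullet> ?g)) \<le> e / 2 * norm (x' - x)"
    proof (rule differentiable_bound[of "ball x (d / 2)" "\<lambda>u. h (u, w x') - u \<bullet> ?g"])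
      fix u assume u: "u \<in> ball x (d / 2)"
      show "((\<lambda>u. h (u, w x') - u \<bullet> ?g) has_derivative
          (\<lambda>v. v \<bullet> fst (grad h (u, w x')) - v \<bullet> ?g)) (at u within ball x (d / 2))"
        by (intro has_derivative_diff has_derivative_Pair_left diff)
          (auto intro!: derivative_eq_intros)
      have "dist (u, w x') (x, y) \<le> dist u x + dist (w x') y"
        by (simp add: dist_Pair_Pair sqrt_sum_squares_le_sum)
      then have "dist (grad h (u, w x')) (grad h (x, y)) < e / 2"
        using u elim by (intro dd) (auto simp: dist_commute)
      moreover have "norm (fst (grad h (u, w x')) - ?g) \<le> dist (grad h (u, w x')) (grad h (x, y))"
        unfolding dist_norm by (metis norm_fst_le prod.collapse fst_diff)
      ultimately show "onorm (\<lambda>v. v \<bullet> fst (grad h (u, w x')) - v \<bullet> ?g) \<le> e / 2"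
        using order_trans[OF onorm_inner_diff_le] by force
    qed (use elim d in auto)
    moreover have "(h (x', w x') - x' \<bullet> ?g) - (h (x, w x') - x \<bullet> ?g)
        = h (x', w x') - h (x, w x') - ?g \<bullet> (x' - x)"
      by (simp add: inner_diff inner_commute)
    moreover have "norm (x' - x) > 0" using elim by simp
    ultimately have "\<bar>h (x', w x') - h (x, w x') - ?g \<bullet> (x' - x)\<bar> / norm (x' - x) \<le> e / 2"
      by (simp add: divide_le_eq)
    also have "\<dots> < e" using e by simp
    finally show ?case by simp
  qed
qed

section \<open>Stability of the saddle point and the gradient of the minimax value\<close>

theorem theorem2p1:
  fixes X :: "(real ^ 'n) set" and Y :: "(real ^ 'm) set"
    and F f :: "(real ^ 'n) \<times> (real ^ 'm) \<Rightarrow> real"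
    and \<mu> \<rho> \<sigma> :: real and x :: "real ^ 'n"
  assumes X: "closed X" "convex X" and Y: "closed Y" "convex Y"
    and F_C1: "continuously_differentiable F"
    and F_Lipschitz: "\<exists>L. L-lipschitz_on (X \<times> Y) (grad F)"
    and F_concave: "\<mu> > 0" "\<forall>x\<in>X. strongly_concave_on Y \<mu> (\<lambda>y. F (x, y))"
    and f_C1: "continuously_differentiable f"
    and f_Lipschitz: "\<exists>L. L-lipschitz_on (X \<times> Y) (grad f)"
    and f_convex: "\<forall>x\<in>X. convex_on Y (\<lambda>y. f (x, y))"
    and S_nonempty: "\<forall>x\<in>X. lower_sol f Y x \<noteq> {}"
    and S_bounded: "\<forall>B. B \<subseteq> X \<and> bounded B \<longrightarrow>
          (\<exists>D. bounded D \<and> (\<forall>x\<in>B. lower_sol f Y x \<inter> D \<noteq> {}))"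
    and params: "\<rho> > 0" "\<sigma> > 0"
    and x: "x \<in> X"
  shows "(\<exists>!p. saddle_point Y (psi F f \<rho> \<sigma> x) p) \<and>
    (phi F f Y \<rho> \<sigma> has_derivative
      (\<lambda>h. (grad (\<lambda>x'. F (x', ystar F f Y \<rho> \<sigma> x)) x
             - \<rho> *\<^sub>R grad (\<lambda>x'. f (x', ystar F f Y \<rho> \<sigma> x)) x
             + \<rho> *\<^sub>R grad (\<lambda>x'. f (x', zstar F f Y \<rho> \<sigma> x)) x) \<bullet> h)) (at x within X)"
proof -
  have diff: "\<And>p. F differentiable (at p)" "\<And>p. f differentiable (at p)"
    using F_C1 f_C1 by (auto simp: continuously_differentiable_def)
  \<comment> \<open>A lower-level minimiser at \<open>x\<close> is a point of
    \<open>Y\<close>.\<close>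
  have Y_ne: "Y \<noteq> {}"
    using S_nonempty x by (auto simp: lower_sol_def is_arg_min_def)
  \<comment> \<open>The parts of \<open>psi\<close> depending on \<open>y\<close> alone and on
    \<open>z\<close> alone. The convex term of \<open>f\<close> goes with a minus sign to the
    concave side and with a plus sign to the convex side.\<close>
  define a where "a u y = F (u, y) + - (\<rho> * f (u, y))" for u y
  define b where "b u z = \<rho> * f (u, z) + \<sigma> / 2 * (norm z)\<^sup>2" for u z
  have psi: "psi F f \<rho> \<sigma> u = (\<lambda>y z. a u y + b u z - \<sigma> * (y \<bullet> z))" for u
    by (simp add: fun_eq_iff psi_def a_def b_def algebra_simps)
  have f_concave: "concave_on Y (\<lambda>y. - (\<rho> * f (u, y)))" if "u \<in> X" for u
    using convex_on_cmul[of \<rho> Y "\<lambda>y. f (u, y)"] f_convex params that by (simp add: concave_on_def)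
  have a: "strongly_concave_on Y \<mu> (a u)" if "u \<in> X" for u
    unfolding a_def using F_concave f_concave that by (intro strongly_concave_on_add_concave) auto
  have b: "strongly_concave_on Y \<sigma> (\<lambda>z. - b u z)" if "u \<in> X" for u
    using strongly_concave_on_add_concave[OF strongly_concave_on_minus_norm_sq[OF Y(2), of \<sigma>] f_concave[OF that]]
    by (simp add: b_def add.commute)
  have cont: "continuous_on Y (\<lambda>y. F (u, y))" "continuous_on Y (\<lambda>y. f (u, y))" for u
    using F_C1 f_C1 by (simp_all add: continuous_on_Pair_right)
  have cont_a: "continuous_on Y (a u)" and cont_b: "continuous_on Y (b u)" for u
    unfolding a_def b_def by (intro continuous_intros cont)+
  have ex1: "\<exists>!p. saddle_point Y (psi F f \<rho> \<sigma> u) p" if u: "u \<in> X" for u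
    using saddle_point_exists[OF a[OF u] b[OF u] F_concave(1) params(2) Y(1) Y_ne cont_a cont_b]
      saddle_point_unique[OF a[OF u] b[OF u] F_concave(1) params(2)]
    unfolding psi by blast
  define ys where "ys = ystar F f Y \<rho> \<sigma>"
  define zs where "zs = zstar F f Y \<rho> \<sigma>"
  have sp: "saddle_point Y (psi F f \<rho> \<sigma> u) (ys u, zs u)" if "u \<in> X" for u
    using theI'[OF ex1[OF that]] by (simp add: ys_def zs_def ystar_def zstar_def saddle_def)
  then have S: "ys u \<in> Y" "zs u \<in> Y" if "u \<in> X" for u
    using that by (auto simp: saddle_point_def)
  have phi: "phi F f Y \<rho> \<sigma> u = psi F f \<rho> \<sigma> u (ys u) (zs u)" if u: "u \<in> X" for u
    unfolding phi_def
  proof (rule min_max_eq_saddle_value[OF sp[OF u]])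
    fix w
    have "continuous_on Y (\<lambda>y. a u y + b u w - \<sigma> * (y \<bullet> w))"
      by (intro continuous_intros cont_a)
    then show "\<exists>m\<in>Y. \<forall>v\<in>Y. psi F f \<rho> \<sigma> u v w \<le> psi F f \<rho> \<sigma> u m w"
      unfolding psi
      using strongly_concave_on_attains_max[OF strongly_concave_on_bilinear[OF a[OF u], of "b u w" \<sigma> w]
          F_concave(1) Y(1) Y_ne] by metis
  qed
  obtain L M where LF: "L-lipschitz_on (X \<times> Y) (grad F)" and Lf: "M-lipschitz_on (X \<times> Y) (grad f)"
    using F_Lipschitz f_Lipschitz by blast
  have LM: "L \<ge> 0" "M \<ge> 0" using LF Lf by (auto dest: lipschitz_on_nonneg)
  \<comment> \<open>\<open>L\<close> accounts for \<open>F\<close>, and \<open>\<rho> * M\<close>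
    for each of the two occurrences of \<open>f\<close>. The smaller modulus \<open>\<kappa>\<close>
    makes the growth control the joint distance of the saddle points.\<close>
  define K where "K = L + 2 * \<rho> * M"
  define \<kappa> where "\<kappa> = min \<mu> \<sigma>"
  have \<kappa>: "\<kappa> > 0" "\<kappa> \<le> \<mu>" "\<kappa> \<le> \<sigma>" using F_concave params by (auto simp: \<kappa>_def)
  have stable: "norm ((ys u, zs u) - (ys x, zs x)) \<le> K / \<kappa> * norm (u - x)" if u: "u \<in> X" for u
  proof -
    define dx dy dz dp where "dx = norm (u - x)" and "dy = norm (ys u - ys x)"
      and "dz = norm (zs u - zs x)" and "dp = norm ((ys u, zs u) - (ys x, zs x))"
    have dp: "dp\<^sup>2 = dy\<^sup>2 + dz\<^sup>2" "dy \<le> dp" "dz \<le> dp" "dp \<ge> 0" "dx \<ge> 0"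
      by (auto simp: dp_def dy_def dz_def dx_def norm_Pair real_le_rsqrt)
    let ?h = "\<lambda>h w w'. (h (u, w') - h (x, w')) - (h (u, w) - h (x, w)) :: real"
    have h: "\<bar>?h F (ys x) (ys u)\<bar> \<le> L * dx * dy" "\<bar>?h f (ys x) (ys u)\<bar> \<le> M * dx * dy"
        "\<bar>?h f (zs x) (zs u)\<bar> \<le> M * dx * dz"
      unfolding dx_def dy_def dz_def using S u x
      by (intro mixed_difference_le[OF _ LF Y(2)] mixed_difference_le[OF _ Lf Y(2)] diff; simp)+
    have "\<kappa> * dp\<^sup>2 \<le> \<mu> * dy\<^sup>2 + \<sigma> * dz\<^sup>2"
      unfolding dp distrib_left by (intro add_mono mult_right_mono \<kappa>) auto
    also have "\<dots> \<le> ((a u (ys u) - a x (ys u)) - (a u (ys x) - a x (ys x)))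
        - ((b u (zs u) - b x (zs u)) - (b u (zs x) - b x (zs x)))"
      unfolding dy_def dz_def
      by (rule saddle_point_perturbation[OF a[OF x] b[OF x] a[OF u] b[OF u]
            sp[OF x, unfolded psi] sp[OF u, unfolded psi]])
    \<comment> \<open>The quadratic term of \<open>b\<close> does not depend on the first argument
      and drops out, leaving mixed differences only.\<close>
    also have "\<dots> = ?h F (ys x) (ys u) - \<rho> * ?h f (ys x) (ys u) - \<rho> * ?h f (zs x) (zs u)"
      by (simp add: a_def b_def algebra_simps)
    also have "\<dots> \<le> \<bar>?h F (ys x) (ys u)\<bar> + \<rho> * \<bar>?h f (ys x) (ys u)\<bar> + \<rho> * \<bar>?h f (zs x) (zs u)\<bar>"
    proof -
      have "- (\<rho> * t) \<le> \<rho> * \<bar>t\<bar>" for t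
        using params(1) by (metis abs_ge_minus_self abs_mult abs_of_pos)
      then show ?thesis by (smt (verit))
    qed
    also have "\<dots> \<le> L * dx * dp + \<rho> * (M * dx * dp) + \<rho> * (M * dx * dp)"
      using params(1) LM dp
      by (intro add_mono mult_left_mono order_trans[OF h(1)] order_trans[OF h(2)] order_trans[OF h(3)]) auto
    also have "\<dots> = dp * (K * dx)" by (simp add: K_def algebra_simps)
    finally have "dp * (\<kappa> * dp) \<le> dp * (K * dx)" by (simp add: power2_eq_square algebra_simps)
    moreover have "0 \<le> K * dx" using LM params(1) dp by (simp add: K_def)
    \<comment> \<open>The factor \<open>dp\<close> is cancelled; if it is 0, nonnegativity of the
      right side suffices.\<close>
    ultimately have "\<kappa> * dp \<le> K * dx" using dp(4) by (cases "dp = 0") auto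
    then show ?thesis using \<kappa>(1) by (simp add: field_simps dp_def dx_def)
  qed
  have X_ev: "\<forall>\<^sub>F u in at x within X. u \<in> X"
    by (simp add: eventually_at_filter)
  have lim_p: "((\<lambda>u. (ys u, zs u)) \<longlongrightarrow> (ys x, zs x)) (at x within X)"
  proof (rule Lim_null_comparison[THEN Lim_null[THEN iffD2]])
    show "\<forall>\<^sub>F u in at x within X. norm ((ys u, zs u) - (ys x, zs x)) \<le> K / \<kappa> * norm (u - x)"
      using X_ev stable by (rule eventually_mono)
    have "((\<lambda>u. K / \<kappa> * norm (u - x)) \<longlongrightarrow> K / \<kappa> * norm (x - x)) (at x within X)"
      by (intro tendsto_intros)
    then show "((\<lambda>u. K / \<kappa> * norm (u - x)) \<longlongrightarrow> 0) (at x within X)" by simp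
  qed
  have lim_ys: "(ys \<longlongrightarrow> ys x) (at x within X)" and lim_zs: "(zs \<longlongrightarrow> zs x) (at x within X)"
    using tendsto_fst[OF lim_p] tendsto_snd[OF lim_p] by simp_all
  define g where "g = fst (grad F (x, ys x)) - \<rho> *\<^sub>R fst (grad f (x, ys x)) + \<rho> *\<^sub>R fst (grad f (x, zs x))"
  \<comment> \<open>Stated for arbitrary \<open>v\<close> and \<open>w\<close> so that it covers
    both mixed pairs of saddle components. In the increment of \<open>psi\<close> the terms with
    \<open>\<sigma>\<close> cancel.\<close>
  have lim: "((\<lambda>u. (psi F f \<rho> \<sigma> u (v u) (w u) - psi F f \<rho> \<sigma> x (v u) (w u) - g \<bullet> (u - x)) / norm (u - x))
      \<longlongrightarrow> 0) (at x within X)"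
    if v: "(v \<longlongrightarrow> ys x) (at x within X)" and w: "(w \<longlongrightarrow> zs x) (at x within X)" for v w
  proof -
    let ?q = "\<lambda>h v y u. (h (u, v u) - h (x, v u) - fst (grad h (x, y)) \<bullet> (u - x)) / norm (u - x)"
    have "((\<lambda>u. ?q F v (ys x) u - \<rho> * ?q f v (ys x) u + \<rho> * ?q f w (zs x) u)
        \<longlongrightarrow> 0 - \<rho> * 0 + \<rho> * 0) (at x within X)"
      by (intro tendsto_intros partial_increment_tendsto F_C1 f_C1 v w)
    moreover have "?q F v (ys x) u - \<rho> * ?q f v (ys x) u + \<rho> * ?q f w (zs x) u
        = (psi F f \<rho> \<sigma> u (v u) (w u) - psi F f \<rho> \<sigma> x (v u) (w u) - g \<bullet> (u - x)) / norm (u - x)" for u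
      by (simp add: psi_def g_def inner_add_left inner_diff_left diff_divide_distrib
          add_divide_distrib algebra_simps)
    ultimately show ?thesis by simp
  qed
  have "((\<lambda>u. (phi F f Y \<rho> \<sigma> u - phi F f Y \<rho> \<sigma> x - g \<bullet> (u - x)) / norm (u - x)) \<longlongrightarrow> 0) (at x within X)"
  \<comment> \<open>Below: \<open>ys x\<close> is a competitor for the maximiser at
    \<open>u\<close>, and \<open>zs u\<close> for the minimiser at \<open>x\<close>. Above, the
    roles are exchanged: \<open>zs x\<close> competes at \<open>u\<close> and \<open>ys u\<close> at
    \<open>x\<close>.\<close>
  proof (rule tendsto_sandwich[OF _ _ lim[OF tendsto_const lim_zs] lim[OF lim_ys tendsto_const]])
    show "\<forall>\<^sub>F u in at x within X.
        (psi F f \<rho> \<sigma> u (ys x) (zs u) - psi F f \<rho> \<sigma> x (ys x) (zs u) - g \<bullet> (u - x)) / norm (u - x)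
        \<le> (phi F f Y \<rho> \<sigma> u - phi F f Y \<rho> \<sigma> x - g \<bullet> (u - x)) / norm (u - x)"
      using X_ev
    proof eventually_elim
      case (elim u)
      then show ?case
        using sp[OF elim] sp[OF x] S[OF elim] S[OF x]
        by (intro divide_right_mono) (auto simp: phi x saddle_point_def intro!: diff_mono)
    qed
    show "\<forall>\<^sub>F u in at x within X.
        (phi F f Y \<rho> \<sigma> u - phi F f Y \<rho> \<sigma> x - g \<bullet> (u - x)) / norm (u - x)
        \<le> (psi F f \<rho> \<sigma> u (ys u) (zs x) - psi F f \<rho> \<sigma> x (ys u) (zs x) - g \<bullet> (u - x)) / norm (u - x)"
      using X_ev
    proof eventually_elim
      case (elim u)
      then show ?case
        using sp[OF elim] sp[OF x] S[OF elim] S[OF x]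
        by (intro divide_right_mono) (auto simp: phi x saddle_point_def intro!: diff_mono)
    qed
  qed
  then have "(phi F f Y \<rho> \<sigma> has_derivative (\<lambda>h. g \<bullet> h)) (at x within X)"
    by (simp add: has_derivative_within bounded_linear_inner_right divide_inverse mult.commute diff_diff_eq)
  moreover have "g = grad (\<lambda>x'. F (x', ystar F f Y \<rho> \<sigma> x)) x
      - \<rho> *\<^sub>R grad (\<lambda>x'. f (x', ystar F f Y \<rho> \<sigma> x)) x
      + \<rho> *\<^sub>R grad (\<lambda>x'. f (x', zstar F f Y \<rho> \<sigma> x)) x"
    by (simp add: g_def grad_Pair_left diff ys_def zs_def)
  ultimately show ?thesis using ex1[OF x] by simp
qed

end
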